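(* Let $\mathcal B$ be a finite set of simple $k$-SAT formulae and let $m(\mathcal B)=\max_{B\in\mathcal B}|B|$. For every $\delta>0$ there exists $C=C(\mathcal B,\delta)>0$ such that for every $n$ there is a collection $\mathcal G$ of formulae on the variable set $X=\{x_1,\dots,x_n\}$ satisfying: (a) every $\mathcal B$-free $k$-SAT formula with variables in $X$ is a subformula of some $G\in\mathcal G$; (b) for every $G\in\mathcal G$ and $B\in\mathcal B$, $G$ has at most $\delta n^{v(B)}$ copies of $B$; (c) $|\mathcal G|\le n^{Cn^{k-1/(m(\mathcal B)-1)}}$.
   Context: A clause is a conjunction of $k$ literals ($x$ or $\overline x$) on $k$ distinct variables; a $k$-SAT formula is a set of clauses; $|B|$ denotes its number of clauses and $v(B)$ the number of variables appearing in some clause of $B$. A formula is simple if no two of its clauses use exactly the same set of $k$ variables. A subformula is a subset of clauses; two formulae are isomorphic if one is obtained from the other by relabeling variables; a copy of $B$ in $G$ is a subformula of $G$ isomorphic to $B$; $G$ is $\mathcal B$-free if it contains no copy of any $B\in\mathcal B$. *)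

theory Defs
  imports Complex_Main
begin

datatype 'a literal = Pos (lit_var: 'a) | Neg (lit_var: 'a)

type_synonym 'a clause = "'a literal set"
type_synonym 'a formula = "'a clause set"

definition clause_vars :: "'a clause \<Rightarrow> 'a set" where
  "clause_vars c = lit_var ` c"

text \<open>Injectivity of \<open>lit_var\<close> on a clause says that its literals are on pairwise distinct
  variables; in particular a variable and its negation never occur together.\<close>

definition k_clause :: "nat \<Rightarrow> 'a clause \<Rightarrow> bool" where
  "k_clause k c \<longleftrightarrow> finite c \<and> card c = k \<and> inj_on lit_var c"

definition ksat_formula :: "nat \<Rightarrow> 'a formula \<Rightarrow> bool" where
  "ksat_formula k F \<longleftrightarrow> finite F \<and> (\<forall>c\<in>F. k_clause k c)"

definition formula_vars :: "'a formula \<Rightarrow> 'a set" where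
  "formula_vars F = (\<Union>c\<in>F. clause_vars c)"

definition num_vars :: "'a formula \<Rightarrow> nat" where
  "num_vars F = card (formula_vars F)"

definition simple_formula :: "'a formula \<Rightarrow> bool" where
  "simple_formula F \<longleftrightarrow> (\<forall>c\<in>F. \<forall>d\<in>F. clause_vars c = clause_vars d \<longrightarrow> c = d)"

text \<open>Relabeling renames variables and keeps the sign of every literal.\<close>

definition relabel :: "('a \<Rightarrow> 'b) \<Rightarrow> 'a formula \<Rightarrow> 'b formula" where
  "relabel f F = (\<lambda>c. map_literal f ` c) ` F"

definition formula_iso :: "'a formula \<Rightarrow> 'b formula \<Rightarrow> bool" where
  "formula_iso F H \<longleftrightarrow> (\<exists>f. inj_on f (formula_vars F) \<and> H = relabel f F)"

definition copies :: "'a formula \<Rightarrow> 'b formula \<Rightarrow> 'b formula set" where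
  "copies B G = {H. H \<subseteq> G \<and> formula_iso B H}"

definition free_of :: "'a formula set \<Rightarrow> 'b formula \<Rightarrow> bool" where
  "free_of \<B> G \<longleftrightarrow> (\<forall>B\<in>\<B>. copies B G = {})"

definition max_clauses :: "'a formula set \<Rightarrow> nat" where
  "max_clauses \<B> = Max (card ` \<B>)"

definition formulae_on :: "nat \<Rightarrow> 'a set \<Rightarrow> 'a formula set" where
  "formulae_on k X = {F. ksat_formula k F \<and> formula_vars F \<subseteq> X}"

end

theory Submission
  imports Defs
begin

text \<open>This is an application of the method of hypergraph containers, to the hypergraphs whose
  vertices are the \<open>k\<close>-clauses over \<open>n\<close> variables and whose edges are the copies of some \<open>B\<close>.
  As \<open>B\<close> is simple, two clauses of a copy span at least \<open>k + 1\<close> variables, so all codegrees are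
  smaller by a factor \<open>n\<close> than the degrees, and \<open>\<tau> = n powr (-1 / (m - 1))\<close> is an admissible
  density of fingerprints.

  Containers for weighted \<open>s\<close>-uniform hypergraphs are built by induction on \<open>s\<close>, by branching over
  the vertices of an independent set \<open>I\<close>. As long as \<open>I\<close> contains a vertex of high degree, choose
  one and add its link to an \<open>(s - 1)\<close>-uniform hypergraph in which \<open>I\<close> stays independent; edges
  containing a set whose degree in the new hypergraph is already large are ignored. If \<open>I\<close> runs out
  of vertices of high degree, the remaining vertices form the container; otherwise the links become
  heavy enough to apply the induction hypothesis to them. In the end, all containers that still have
  many copies of some \<open>B\<close> are refined a bounded number of times.\<close>

section \<open>Containers for weighted hypergraphs\<close>

text \<open>Edges carry real weights because links of several vertices are added up and may share
  edges. The degree of \<open>{}\<close> is the total weight.\<close>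

definition deg :: "'a set \<Rightarrow> ('a set \<Rightarrow> real) \<Rightarrow> 'a set \<Rightarrow> real" where
  "deg V w S = (\<Sum>e \<in> {e. e \<subseteq> V \<and> S \<subseteq> e}. w e)"

definition uniform_weight :: "'a set \<Rightarrow> nat \<Rightarrow> ('a set \<Rightarrow> real) \<Rightarrow> bool" where
  "uniform_weight V s w \<longleftrightarrow> (\<forall>e. 0 \<le> w e) \<and> (\<forall>e. w e \<noteq> 0 \<longrightarrow> e \<subseteq> V \<and> card e = s)"

definition indep_set :: "('a set \<Rightarrow> real) \<Rightarrow> 'a set \<Rightarrow> bool" where
  "indep_set w I \<longleftrightarrow> (\<forall>e. w e \<noteq> 0 \<longrightarrow> \<not> e \<subseteq> I)"

definition link :: "'a \<Rightarrow> ('a set \<Rightarrow> real) \<Rightarrow> 'a set \<Rightarrow> real" where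
  "link v w e = (if v \<in> e then 0 else w (insert v e))"

text \<open>One round of a container argument. Containers are required to omit \<open>x\<close>
  vertices, not to have few edges: this is the progress that bounds the number of rounds.\<close>

definition coverable :: "'a set \<Rightarrow> real \<Rightarrow> nat \<Rightarrow> ('a set \<Rightarrow> bool) \<Rightarrow> bool" where
  "coverable V x M P \<longleftrightarrow> (\<exists>\<C>. finite \<C> \<and> card \<C> \<le> M \<and>
     (\<forall>C\<in>\<C>. C \<subseteq> V \<and> x \<le> real (card (V - C))) \<and>
     (\<forall>I\<subseteq>V. P I \<longrightarrow> (\<exists>C\<in>\<C>. I \<subseteq> C)))"

section \<open>Degree identities and averaging\<close>

lemma deg_add: "deg V (\<lambda>e. w e + w' e) S = deg V w S + deg V w' S"
  by (simp add: deg_def sum.distrib)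

lemma deg_nonneg: "uniform_weight V s w \<Longrightarrow> 0 \<le> deg V w S"
  by (auto simp: deg_def uniform_weight_def intro: sum_nonneg)

lemma deg_link:
  assumes "finite V" "v \<in> V"
  shows "deg V (link v w) S = (if v \<in> S then 0 else deg V w (insert v S))"
proof (cases "v \<in> S")
  case True
  then show ?thesis
    unfolding deg_def link_def by (auto intro!: sum.neutral)
next
  case False
  have fin: "finite {e. e \<subseteq> V \<and> S \<subseteq> e}"
    using assms by (auto intro: finite_subset[of _ "Pow V"])
  have "deg V (link v w) S = (\<Sum>e \<in> {e. e \<subseteq> V \<and> S \<subseteq> e \<and> v \<notin> e}. w (insert v e))"
    unfolding deg_def link_def by (rule sum.mono_neutral_cong_right) (use fin in auto)
  also have "\<dots> = (\<Sum>e \<in> {e. e \<subseteq> V \<and> insert v S \<subseteq> e}. w e)"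
    by (rule sum.reindex_bij_witness[where i = "\<lambda>e. e - {v}" and j = "insert v"])
      (use assms False in \<open>auto simp: insert_absorb\<close>)
  finally show ?thesis
    using False by (simp add: deg_def)
qed

text \<open>Count pairs of a set and an edge containing it by edges: every edge of positive weight
  has \<open>2 ^ s\<close> subsets.\<close>

lemma sum_deg_subsets:
  assumes "finite V" "uniform_weight V s w"
  shows "(\<Sum>S\<in>Pow V. deg V w S) = 2 ^ s * deg V w {}"
proof -
  have "(\<Sum>S\<in>Pow V. deg V w S) = (\<Sum>S\<in>Pow V. \<Sum>e\<in>Pow V. if S \<subseteq> e then w e else 0)"
    unfolding deg_def using assms(1)
    by (intro sum.cong sum.mono_neutral_cong_left) auto
  also have "\<dots> = (\<Sum>e\<in>Pow V. \<Sum>S\<in>Pow V. if S \<subseteq> e then w e else 0)"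
    by (rule sum.swap)
  also have "\<dots> = (\<Sum>e\<in>Pow V. 2 ^ s * w e)"
  proof (rule sum.cong)
    fix e assume e: "e \<in> Pow V"
    then have "(\<Sum>S\<in>Pow V. if S \<subseteq> e then w e else 0) = (\<Sum>S\<in>Pow e. w e)"
      using assms(1) by (intro sum.mono_neutral_cong_right) auto
    also have "\<dots> = 2 ^ card e * w e"
      using e assms(1) by (simp add: card_Pow finite_subset[of e V])
    also have "\<dots> = 2 ^ s * w e"
      using assms(2) by (cases "w e = 0") (auto simp: uniform_weight_def)
    finally show "(\<Sum>S\<in>Pow V. if S \<subseteq> e then w e else 0) = 2 ^ s * w e" .
  qed simp
  also have "\<dots> = 2 ^ s * deg V w {}"
    by (simp add: deg_def sum_distrib_left Pow_def)
  finally show ?thesis .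
qed

lemma sum_deg_vertices:
  assumes "finite V" "uniform_weight V s w"
  shows "(\<Sum>v\<in>V. deg V w {v}) = real s * deg V w {}"
proof -
  have "(\<Sum>v\<in>V. deg V w {v}) = (\<Sum>v\<in>V. \<Sum>e\<in>Pow V. if v \<in> e then w e else 0)"
    unfolding deg_def using assms(1)
    by (intro sum.cong sum.mono_neutral_cong_left) auto
  also have "\<dots> = (\<Sum>e\<in>Pow V. \<Sum>v\<in>V. if v \<in> e then w e else 0)"
    by (rule sum.swap)
  also have "\<dots> = (\<Sum>e\<in>Pow V. real s * w e)"
  proof (rule sum.cong)
    fix e assume e: "e \<in> Pow V"
    then have "(\<Sum>v\<in>V. if v \<in> e then w e else 0) = (\<Sum>v\<in>e. w e)"
      using assms(1) by (intro sum.mono_neutral_cong_right) auto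
    also have "\<dots> = real s * w e"
      using assms(2) by (cases "w e = 0") (auto simp: uniform_weight_def)
    finally show "(\<Sum>v\<in>V. if v \<in> e then w e else 0) = real s * w e" .
  qed simp
  also have "\<dots> = real s * deg V w {}"
    by (simp add: deg_def sum_distrib_left Pow_def)
  finally show ?thesis .
qed

text \<open>Vertices of low degree contribute at most \<open>\<delta> / 2 * D * real N\<close> to
  the degree sum. The other half must come from the rest, where each vertex supplies at most
  \<open>c * D\<close>.\<close>

lemma many_vertices_of_high_degree:
  assumes "finite V" "card V \<le> N" "0 < D" "0 < c" "0 < \<delta>"
    and "uniform_weight V (Suc s) w" "\<delta> * D * real N \<le> deg V w {}"
    and cap: "\<And>v. v \<in> V \<Longrightarrow> deg V w {v} \<le> c * D"
  shows "\<delta> / (2 * c) * real N \<le> real (card {v\<in>V. \<delta> / 2 * D \<le> deg V w {v}})"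
proof -
  let ?H = "{v\<in>V. \<delta> / 2 * D \<le> deg V w {v}}"
  have nn: "0 \<le> deg V w {}"
    using assms deg_nonneg by blast
  have "\<delta> * D * real N \<le> real (Suc s) * deg V w {}"
    using assms(7) mult_right_mono[OF _ nn, of 1 "real (Suc s)"] by simp
  also have "\<dots> = (\<Sum>v\<in>V. deg V w {v})"
    using sum_deg_vertices[OF assms(1,6)] by simp
  also have "\<dots> = (\<Sum>v\<in>?H. deg V w {v}) + (\<Sum>v\<in>V - ?H. deg V w {v})"
    using assms(1) by (subst add.commute, intro sum.subset_diff) auto
  also have "\<dots> \<le> (\<Sum>v\<in>?H. c * D) + (\<Sum>v\<in>V - ?H. \<delta> / 2 * D)"
    by (intro add_mono sum_mono) (use cap in auto)
  also have "\<dots> \<le> real (card ?H) * (c * D) + real N * (\<delta> / 2 * D)"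
  proof -
    have "card (V - ?H) \<le> N"
      using card_mono[OF assms(1), of "V - ?H"] assms(2) by auto
    then show ?thesis
      using assms(3,5) by (auto intro!: mult_right_mono)
  qed
  finally have "D * (\<delta> / 2 * real N) \<le> D * (real (card ?H) * c)"
    by (simp add: algebra_simps)
  then have "\<delta> / 2 * real N \<le> real (card ?H) * c"
    using assms(3) by simp
  then show ?thesis
    using assms(4) by (simp add: field_simps)
qed

text \<open>About \<open>\<tau> * real N\<close> links of weight about \<open>D\<close> have total
  weight of order \<open>(\<tau> * D) * real N\<close>. So \<open>D\<close> is rescaled to
  \<open>\<tau> * D\<close>, and the threshold is the matching codegree
  \<open>\<tau> ^ (card S - 1) * (\<tau> * D)\<close>. The empty set, contained in every edge, is
  left out.\<close>

definition saturated :: "'a set \<Rightarrow> real \<Rightarrow> real \<Rightarrow> ('a set \<Rightarrow> real) \<Rightarrow> 'a set set" where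
  "saturated V \<tau> D w' = {S. S \<subseteq> V \<and> S \<noteq> {} \<and> \<tau> ^ card S * D \<le> deg V w' S}"

definition unsaturated_part ::
    "'a set \<Rightarrow> real \<Rightarrow> real \<Rightarrow> ('a set \<Rightarrow> real) \<Rightarrow> ('a set \<Rightarrow> real) \<Rightarrow> 'a set \<Rightarrow> real" where
  "unsaturated_part V \<tau> D w' w e = (if \<exists>S\<in>saturated V \<tau> D w'. S \<subseteq> e then 0 else w e)"

lemma uniform_unsaturated_part:
  "uniform_weight V s w \<Longrightarrow> uniform_weight V s (unsaturated_part V \<tau> D w' w)"
  by (auto simp: unsaturated_part_def uniform_weight_def)

lemma deg_unsaturated_part_le:
  "uniform_weight V s w \<Longrightarrow> deg V (unsaturated_part V \<tau> D w' w) S \<le> deg V w S"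
  by (auto simp: deg_def unsaturated_part_def uniform_weight_def intro: sum_mono)

text \<open>A set \<open>S\<close> is saturated only if its degree in \<open>w'\<close> is at least \<open>\<tau> / c\<close> times the largest
  possible degree in \<open>w\<close>, so the weight that saturation destroys is controlled by \<open>w'\<close>.\<close>

lemma unsaturated_part_heavy:
  assumes "finite V" "0 < D" "0 < \<tau>" "0 < c"
    and w: "uniform_weight V (Suc s) w" and w': "uniform_weight V s w'"
    and cap: "\<And>S. S \<subseteq> V \<Longrightarrow> S \<noteq> {} \<Longrightarrow> deg V w S \<le> c * \<tau> ^ (card S - 1) * D"
  shows "deg V w {} - c / \<tau> * 2 ^ s * deg V w' {} \<le> deg V (unsaturated_part V \<tau> D w' w) {}"
proof -
  let ?Sat = "saturated V \<tau> D w'"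
  let ?a = "unsaturated_part V \<tau> D w' w"
  have finS: "finite ?Sat"
    using assms(1) by (auto simp: saturated_def intro: finite_subset[of _ "Pow V"])
  have wnn: "0 \<le> w e" for e
    using w by (auto simp: uniform_weight_def)
  \<comment> \<open>A discarded edge has at least one saturated subset to which its weight can be
    charged.\<close>
  have pointwise: "w e \<le> ?a e + (\<Sum>S\<in>?Sat. if S \<subseteq> e then w e else 0)" for e
  proof (cases "\<exists>S\<in>?Sat. S \<subseteq> e")
    case True
    then obtain S where S: "S \<in> ?Sat" "S \<subseteq> e" by blast
    have "(if S \<subseteq> e then w e else 0) \<le> (\<Sum>S\<in>?Sat. if S \<subseteq> e then w e else 0)"
      by (rule member_le_sum) (use S finS wnn in auto)
    then show ?thesis
      using S True by (auto simp: unsaturated_part_def)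
  next
    case False
    then show ?thesis
      using wnn by (auto simp: unsaturated_part_def intro!: sum_nonneg)
  qed
  have "deg V w {} \<le> (\<Sum>e\<in>Pow V. ?a e + (\<Sum>S\<in>?Sat. if S \<subseteq> e then w e else 0))"
    unfolding deg_def Pow_def using pointwise by (auto intro!: sum_mono)
  also have "\<dots> = deg V ?a {} + (\<Sum>e\<in>Pow V. \<Sum>S\<in>?Sat. if S \<subseteq> e then w e else 0)"
    by (simp add: sum.distrib deg_def Pow_def)
  also have "(\<Sum>e\<in>Pow V. \<Sum>S\<in>?Sat. if S \<subseteq> e then w e else 0)
      = (\<Sum>S\<in>?Sat. \<Sum>e\<in>Pow V. if S \<subseteq> e then w e else 0)"
    by (rule sum.swap)
  also have "\<dots> = (\<Sum>S\<in>?Sat. deg V w S)"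
    unfolding deg_def using assms(1)
    by (intro sum.cong sum.mono_neutral_cong_right) auto
  also have "\<dots> \<le> (\<Sum>S\<in>?Sat. c / \<tau> * deg V w' S)"
  proof (rule sum_mono)
    fix S assume S: "S \<in> ?Sat"
    then have S': "S \<subseteq> V" "S \<noteq> {}" "\<tau> ^ card S * D \<le> deg V w' S"
      by (auto simp: saturated_def)
    then have "card S \<noteq> 0"
      using assms(1) finite_subset by fastforce
    then have "c * \<tau> ^ (card S - 1) * D = c / \<tau> * (\<tau> ^ card S * D)"
      using assms(3) by (cases "card S") auto
    also have "\<dots> \<le> c / \<tau> * deg V w' S"
      using S'(3) assms(3,4) by (intro mult_left_mono) auto
    finally show "deg V w S \<le> c / \<tau> * deg V w' S"
      using cap[OF S'(1,2)] by linarith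
  qed
  also have "\<dots> \<le> (\<Sum>S\<in>Pow V. c / \<tau> * deg V w' S)"
    by (rule sum_mono2)
      (use assms(1,3,4) deg_nonneg[OF w'] in \<open>auto simp: saturated_def\<close>)
  also have "\<dots> = c / \<tau> * 2 ^ s * deg V w' {}"
    using sum_deg_subsets[OF assms(1) w'] by (simp only: sum_distrib_left[symmetric] mult.assoc)
  finally show ?thesis by linarith
qed

section \<open>Branching and the greedy choice of vertices\<close>

lemma coverable_mono:
  assumes "coverable V x M P" "y \<le> x" "M \<le> M'" "\<And>I. I \<subseteq> V \<Longrightarrow> Q I \<Longrightarrow> P I"
  shows "coverable V y M' Q"
  using assms unfolding coverable_def by (meson order_trans)

text \<open>A set that avoids \<open>H\<close> lies in the single container \<open>V - H\<close>;
  any other set contains some \<open>v\<close> in \<open>H\<close> and is covered by the family for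
  that \<open>v\<close>.\<close>

lemma coverable_branch:
  assumes "finite V" "H \<subseteq> V" "x \<le> real (card H)"
    and "\<And>v. v \<in> H \<Longrightarrow> coverable V x M (\<lambda>I. P I \<and> v \<in> I)"
  shows "coverable V x (1 + card V * M) P"
proof -
  obtain \<C> where \<C>: "finite (\<C> v) \<and> card (\<C> v) \<le> M \<and>
     (\<forall>C\<in>\<C> v. C \<subseteq> V \<and> x \<le> real (card (V - C))) \<and>
     (\<forall>I\<subseteq>V. P I \<and> v \<in> I \<longrightarrow> (\<exists>C\<in>\<C> v. I \<subseteq> C))" if "v \<in> H" for v
    using assms(4) unfolding coverable_def by metis
  let ?F = "insert (V - H) (\<Union>v\<in>H. \<C> v)"
  have finH: "finite H" using assms finite_subset by blast
  have fin: "finite (\<Union>v\<in>H. \<C> v)" using finH \<C> by blast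
  have "card ?F \<le> 1 + card (\<Union>v\<in>H. \<C> v)"
    using card_insert_le_m1 fin by (simp add: card_insert_if)
  also have "card (\<Union>v\<in>H. \<C> v) \<le> (\<Sum>v\<in>H. card (\<C> v))"
    by (rule card_UN_le[OF finH])
  also have "\<dots> \<le> (\<Sum>v\<in>H. M)"
    by (rule sum_mono) (use \<C> in auto)
  also have "\<dots> \<le> card V * M"
    using card_mono[OF assms(1,2)] by simp
  finally have card: "card ?F \<le> 1 + card V * M" by simp
  have "V - (V - H) = H" using assms(2) by blast
  then have good: "\<forall>C\<in>?F. C \<subseteq> V \<and> x \<le> real (card (V - C))"
    using \<C> assms(3) by auto
  have "\<exists>C\<in>?F. I \<subseteq> C" if I: "I \<subseteq> V" "P I" for I
  proof (cases "I \<inter> H = {}")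
    case True
    then show ?thesis using I by auto
  next
    case False
    then obtain v where "v \<in> I" "v \<in> H" by blast
    then show ?thesis using \<C>[of v] I by blast
  qed
  with fin card good show ?thesis
    unfolding coverable_def by (intro exI[of _ ?F]) auto
qed

text \<open>The invariant of the greedy procedure: \<open>w'\<close> collects the links of the \<open>i\<close> vertices chosen
  so far, each link being taken in the part of \<open>w\<close> that avoids the currently saturated sets.\<close>

definition link_state ::
    "'a set \<Rightarrow> nat \<Rightarrow> real \<Rightarrow> real \<Rightarrow> real \<Rightarrow> real \<Rightarrow> nat \<Rightarrow> ('a set \<Rightarrow> real) \<Rightarrow> bool" where
  "link_state V s \<tau> D \<beta> c i w' \<longleftrightarrow> uniform_weight V s w' \<and>
     real i * (\<beta> * D) \<le> deg V w' {} \<and> deg V w' {} \<le> real i * (c * D) \<and>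
     (\<forall>S\<subseteq>V. S \<noteq> {} \<longrightarrow> deg V w' S \<le> (1 + c) * \<tau> ^ card S * D)"

text \<open>A saturated set gains no further degree, as all edges through it are discarded. An
  unsaturated set has degree below \<open>\<tau> ^ card S * D\<close> in \<open>w'\<close>, and one
  link adds at most the degree of \<open>insert v S\<close> in \<open>w\<close>, that is
  \<open>c * \<tau> ^ card S * D\<close>. Hence the factor \<open>1 + c\<close>.\<close>

lemma link_state_step:
  assumes "finite V" "0 < D" "0 < \<tau>" "0 < c" "v \<in> V"
    and w: "uniform_weight V (Suc s) w"
    and cap: "\<And>S. S \<subseteq> V \<Longrightarrow> S \<noteq> {} \<Longrightarrow> deg V w S \<le> c * \<tau> ^ (card S - 1) * D"
    and w': "link_state V s \<tau> D \<beta> c i w'"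
    and high: "\<beta> * D \<le> deg V (unsaturated_part V \<tau> D w' w) {v}"
  shows "link_state V s \<tau> D \<beta> c (Suc i)
    (\<lambda>e. w' e + link v (unsaturated_part V \<tau> D w' w) e)"
proof -
  let ?a = "unsaturated_part V \<tau> D w' w"
  have ann: "0 \<le> ?a e" for e
    using w by (auto simp: unsaturated_part_def uniform_weight_def)
  have asupp: "?a e \<noteq> 0 \<Longrightarrow> w e \<noteq> 0" for e
    by (auto simp: unsaturated_part_def split: if_splits)
  have w'uni: "uniform_weight V s w'"
    and w'tot: "real i * (\<beta> * D) \<le> deg V w' {}" "deg V w' {} \<le> real i * (c * D)"
    and w'cap: "\<And>S. S \<subseteq> V \<Longrightarrow> S \<noteq> {} \<Longrightarrow> deg V w' S \<le> (1 + c) * \<tau> ^ card S * D"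
    using w' unfolding link_state_def by blast+
  have luni: "e \<subseteq> V \<and> card e = s" if "link v ?a e \<noteq> 0" for e
  proof -
    have "v \<notin> e" "w (insert v e) \<noteq> 0"
      using that asupp by (auto simp: link_def split: if_splits)
    then have "insert v e \<subseteq> V" "card (insert v e) = Suc s"
      using w by (auto simp: uniform_weight_def)
    moreover from this have "finite e"
      using assms(1) by (meson finite_insert finite_subset)
    ultimately show ?thesis using \<open>v \<notin> e\<close> by auto
  qed
  have uni: "uniform_weight V s (\<lambda>e. w' e + link v ?a e)"
    unfolding uniform_weight_def
  proof (intro conjI allI impI)
    fix e
    show "0 \<le> w' e + link v ?a e"
      using w'uni ann by (auto simp: uniform_weight_def link_def)
    assume "w' e + link v ?a e \<noteq> 0"
    then have "w' e \<noteq> 0 \<or> link v ?a e \<noteq> 0" by auto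
    then show "e \<subseteq> V" "card e = s"
      using luni w'uni by (auto simp: uniform_weight_def)
  qed
  have "deg V ?a {v} \<le> c * D"
    using order_trans[OF deg_unsaturated_part_le[OF w] cap, of "{v}"] assms(5) by simp
  then have total: "real (Suc i) * (\<beta> * D) \<le> deg V (\<lambda>e. w' e + link v ?a e) {}"
      "deg V (\<lambda>e. w' e + link v ?a e) {} \<le> real (Suc i) * (c * D)"
    using w'tot high by (simp_all add: deg_add deg_link[OF assms(1,5)] algebra_simps)
  have "deg V (\<lambda>e. w' e + link v ?a e) S \<le> (1 + c) * \<tau> ^ card S * D"
    if S: "S \<subseteq> V" "S \<noteq> {}" for S
  proof -
    have old: "deg V w' S \<le> (1 + c) * \<tau> ^ card S * D"
      by (rule w'cap[OF S])
    consider "v \<in> S" | "v \<notin> S" "S \<in> saturated V \<tau> D w'" | "v \<notin> S" "S \<notin> saturated V \<tau> D w'"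
      by blast
    then show ?thesis
    proof cases
      case 1
      then show ?thesis using old by (simp add: deg_add deg_link[OF assms(1,5)])
    next
      case 2
      then have "?a e = 0" if "insert v S \<subseteq> e" for e
        using that by (auto simp: unsaturated_part_def)
      then have "deg V ?a (insert v S) = 0"
        unfolding deg_def by (intro sum.neutral) auto
      then show ?thesis using old 2 by (simp add: deg_add deg_link[OF assms(1,5)])
    next
      case 3
      have "finite S" using S assms(1) finite_subset by blast
      then have "deg V ?a (insert v S) \<le> c * \<tau> ^ card S * D"
        using order_trans[OF deg_unsaturated_part_le[OF w] cap, of "insert v S"] S assms(5) 3 by simp
      moreover have "deg V w' S \<le> \<tau> ^ card S * D"
        using 3 S by (auto simp: saturated_def)
      ultimately show ?thesis
        using 3 by (simp add: deg_add deg_link[OF assms(1,5)] algebra_simps)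
    qed
  qed
  with uni total show ?thesis unfolding link_state_def by blast
qed

lemma indep_set_link_step:
  assumes "indep_set w I" "indep_set w' I" "v \<in> I"
  shows "indep_set (\<lambda>e. w' e + link v (unsaturated_part V \<tau> D w'' w) e) I"
  unfolding indep_set_def
proof (intro allI impI)
  fix e assume "w' e + link v (unsaturated_part V \<tau> D w'' w) e \<noteq> 0"
  then have "w' e \<noteq> 0 \<or> w (insert v e) \<noteq> 0"
    by (auto simp: link_def unsaturated_part_def split: if_splits)
  then show "\<not> e \<subseteq> I"
    using assms unfolding indep_set_def by (meson insert_subset)
qed

text \<open>Here \<open>i\<close> links are collected and \<open>t\<close> are still to come. A step
  branches over at most \<open>N\<close> vertices and adds one immediate container, whence a factor
  \<open>N + 1\<close>. While \<open>i < L\<close>, saturation destroys at most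
  \<open>2 ^ s * c\<^sup>2 * \<gamma> * D * real N\<close>, which is at most half of the guaranteed
  weight; the remaining half still yields \<open>\<epsilon> * real N\<close> vertices of degree at
  least \<open>\<delta> / 4 * D\<close>.\<close>

lemma greedy_containers:
  fixes V :: "'a set" and c D \<delta> \<tau> \<gamma> \<epsilon> :: real and N t L M :: nat
  assumes V: "finite V" "card V \<le> N" and pos: "0 < D" "0 < \<tau>" "0 < c" "0 < \<delta>"
    and w: "uniform_weight V (Suc s) w" "\<delta> * D * real N \<le> deg V w {}"
    and cap: "\<And>S. S \<subseteq> V \<Longrightarrow> S \<noteq> {} \<Longrightarrow> deg V w S \<le> c * \<tau> ^ (card S - 1) * D"
    and \<gamma>: "2 ^ s * c\<^sup>2 * \<gamma> \<le> \<delta> / 2" and L: "real L \<le> \<gamma> * \<tau> * real N + 1"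
    and \<epsilon>: "\<epsilon> \<le> \<delta> / (4 * c)" and M: "1 \<le> M"
    and final: "\<And>w'. link_state V s \<tau> D (\<delta> / 4) c L w' \<Longrightarrow>
      coverable V (\<epsilon> * real N) M (indep_set w')"
  shows "i + t = L \<Longrightarrow> link_state V s \<tau> D (\<delta> / 4) c i w' \<Longrightarrow>
    coverable V (\<epsilon> * real N) ((N + 1) ^ t * M) (\<lambda>I. indep_set w I \<and> indep_set w' I)"
proof (induction t arbitrary: i w')
  case 0
  then show ?case
    by (intro coverable_mono[OF final]) auto
next
  case (Suc t)
  let ?a = "unsaturated_part V \<tau> D w' w"
  let ?H = "{v\<in>V. \<delta> / 2 / 2 * D \<le> deg V ?a {v}}"
  have w': "uniform_weight V s w'" "deg V w' {} \<le> real i * (c * D)"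
    using Suc.prems by (auto simp: link_state_def)
  \<comment> \<open>As \<open>i\<close> is at most \<open>L - 1\<close>, the rounding term 1 in the
    bound on \<open>L\<close> disappears.\<close>
  have "real i \<le> \<gamma> * \<tau> * real N"
    using Suc.prems(1) L by linarith
  then have "real i * (c * D) \<le> \<gamma> * \<tau> * real N * (c * D)"
    using pos by (intro mult_right_mono) auto
  with w'(2) have "deg V w' {} \<le> \<gamma> * \<tau> * real N * (c * D)" by (rule order_trans)
  then have "c / \<tau> * 2 ^ s * deg V w' {} \<le> c / \<tau> * 2 ^ s * (\<gamma> * \<tau> * real N * (c * D))"
    using pos by (intro mult_left_mono) auto
  also have "\<dots> = (2 ^ s * c\<^sup>2 * \<gamma>) * (D * real N)"
    using pos by (simp add: power2_eq_square)
  also have "\<dots> \<le> \<delta> / 2 * (D * real N)"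
    using \<gamma> pos by (intro mult_right_mono) auto
  finally have "c / \<tau> * 2 ^ s * deg V w' {} \<le> \<delta> / 2 * (D * real N)" .
  moreover have "deg V w {} - c / \<tau> * 2 ^ s * deg V w' {} \<le> deg V ?a {}"
    by (rule unsaturated_part_heavy[OF V(1) pos(1-3) w(1) w'(1) cap])
  ultimately have heavy: "\<delta> / 2 * D * real N \<le> deg V ?a {}"
    using w(2) by argo
  note auni = uniform_unsaturated_part[OF w(1), of \<tau> D w']
  have acap: "deg V ?a {v} \<le> c * D" if "v \<in> V" for v
    using order_trans[OF deg_unsaturated_part_le[OF w(1)] cap, of "{v}"] that by simp
  have "\<delta> / 2 / (2 * c) * real N \<le> real (card ?H)"
    using many_vertices_of_high_degree[OF V pos(1,3) _ auni heavy acap] pos by simp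
  moreover have "\<epsilon> * real N \<le> \<delta> / 2 / (2 * c) * real N"
    using \<epsilon> by (intro mult_right_mono) auto
  ultimately have H: "\<epsilon> * real N \<le> real (card ?H)" by linarith
  have "coverable V (\<epsilon> * real N) ((N + 1) ^ t * M)
      (\<lambda>I. (indep_set w I \<and> indep_set w' I) \<and> v \<in> I)" if v: "v \<in> ?H" for v
  proof -
    have "link_state V s \<tau> D (\<delta> / 4) c (Suc i) (\<lambda>e. w' e + link v ?a e)"
      by (rule link_state_step[OF V(1) pos(1-3) _ w(1) cap Suc.prems(2)]) (use v in auto)
    with Suc.prems(1) have "coverable V (\<epsilon> * real N) ((N + 1) ^ t * M)
        (\<lambda>I. indep_set w I \<and> indep_set (\<lambda>e. w' e + link v ?a e) I)"
      by (intro Suc.IH) auto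
    then show ?thesis
      by (rule coverable_mono) (auto intro: indep_set_link_step)
  qed
  from coverable_branch[OF V(1) _ H this]
  have "coverable V (\<epsilon> * real N) (1 + card V * ((N + 1) ^ t * M))
      (\<lambda>I. indep_set w I \<and> indep_set w' I)" by auto
  then show ?case
  proof (rule coverable_mono)
    have "1 \<le> (N + 1) ^ t * M" using M by simp
    moreover have "card V * ((N + 1) ^ t * M) \<le> N * ((N + 1) ^ t * M)"
      using V(2) by (rule mult_right_mono) simp
    moreover have "(N + 1) ^ Suc t * M = (N + 1) ^ t * M + N * ((N + 1) ^ t * M)"
      by (simp add: algebra_simps)
    ultimately show "1 + card V * ((N + 1) ^ t * M) \<le> (N + 1) ^ Suc t * M"
      by linarith
  qed auto
qed

text \<open>In the induction, the collected links satisfy the hypotheses with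
  \<open>\<tau> * D\<close> for \<open>D\<close>, \<open>1 + c\<close> for \<open>c\<close> and a
  smaller \<open>\<delta>\<close>, while \<open>\<tau>\<close> and \<open>N\<close> are kept. Every
  level takes at most \<open>nat \<lceil>\<tau> * real N\<rceil>\<close> branching steps, which
  gives the factor \<open>s\<close> in the exponent.\<close>

theorem hypergraph_containers:
  assumes "0 < \<delta>" "0 < c"
  shows "\<exists>\<epsilon>>0. \<forall>(V :: 'a set) N D \<tau> w. finite V \<longrightarrow> card V \<le> N \<longrightarrow> 0 < N \<longrightarrow> 0 < D \<longrightarrow> 0 < \<tau> \<longrightarrow>
    uniform_weight V s w \<longrightarrow> \<delta> * D * real N \<le> deg V w {} \<longrightarrow>
    (\<forall>S\<subseteq>V. S \<noteq> {} \<longrightarrow> deg V w S \<le> c * \<tau> ^ (card S - 1) * D) \<longrightarrow>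
    coverable V (\<epsilon> * real N) ((N + 1) ^ (s * nat \<lceil>\<tau> * real N\<rceil>)) (indep_set w)"
  using assms
proof (induction s arbitrary: \<delta> c)
  case 0
  \<comment> \<open>Positive total weight in uniformity 0 means that \<open>{}\<close> is an edge,
    so no set is independent and the empty family covers for every \<open>x\<close>.\<close>
  have "coverable V x 1 (indep_set w)"
    if "0 < N" "0 < D" "finite V" "uniform_weight V 0 w" "\<delta> * D * real N \<le> deg V w {}"
    for V :: "'a set" and x D N w
  proof -
    have "0 < deg V w {}"
      using that 0 by (smt (verit, best) mult_pos_pos of_nat_0_less_iff)
    then obtain e where "e \<subseteq> V" "w e \<noteq> 0"
      unfolding deg_def by (metis (no_types, lifting) less_irrefl mem_Collect_eq sum.neutral)
    then have "w {} \<noteq> 0"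
      using that(3,4) unfolding uniform_weight_def by (metis card_0_eq finite_subset)
    then show ?thesis
      by (auto simp: coverable_def indep_set_def intro!: exI[of _ "{}"])
  qed
  then show ?case
    by (intro exI[of _ 1]) auto
next
  case (Suc s)
  \<comment> \<open>The second bound lets saturation destroy at most half of the weight; the bound 1
    keeps the number of steps within \<open>nat \<lceil>\<tau> * real N\<rceil>\<close>.\<close>
  define \<gamma> where "\<gamma> = min 1 (\<delta> / (2 * 2 ^ s * c\<^sup>2))"
  have \<gamma>: "0 < \<gamma>" "\<gamma> \<le> 1" "2 ^ s * c\<^sup>2 * \<gamma> \<le> \<delta> / 2"
  proof -
    show "0 < \<gamma>" "\<gamma> \<le> 1" using Suc.prems by (auto simp: \<gamma>_def)
    have "2 ^ s * c\<^sup>2 * \<gamma> \<le> 2 ^ s * c\<^sup>2 * (\<delta> / (2 * 2 ^ s * c\<^sup>2))"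
      by (intro mult_left_mono) (auto simp: \<gamma>_def)
    also have "\<dots> = \<delta> / 2" using Suc.prems by simp
    finally show "2 ^ s * c\<^sup>2 * \<gamma> \<le> \<delta> / 2" .
  qed
  have "0 < \<gamma> * (\<delta> / 4)" "0 < 1 + c" using \<gamma> Suc.prems by auto
  from Suc.IH[OF this] obtain \<epsilon>' where \<epsilon>': "\<epsilon>' > 0"
    and IH: "\<And>(V :: 'a set) N D \<tau> w. finite V \<Longrightarrow> card V \<le> N \<Longrightarrow> 0 < N \<Longrightarrow> 0 < D \<Longrightarrow> 0 < \<tau> \<Longrightarrow>
      uniform_weight V s w \<Longrightarrow> \<gamma> * (\<delta> / 4) * D * real N \<le> deg V w {} \<Longrightarrow>
      (\<forall>S\<subseteq>V. S \<noteq> {} \<longrightarrow> deg V w S \<le> (1 + c) * \<tau> ^ (card S - 1) * D) \<Longrightarrow>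
      coverable V (\<epsilon>' * real N) ((N + 1) ^ (s * nat \<lceil>\<tau> * real N\<rceil>)) (indep_set w)"
    by blast
  define \<epsilon> where "\<epsilon> = min \<epsilon>' (\<delta> / (4 * c))"
  have \<epsilon>: "0 < \<epsilon>" "\<epsilon> \<le> \<epsilon>'" "\<epsilon> \<le> \<delta> / (4 * c)"
    using \<epsilon>' Suc.prems by (auto simp: \<epsilon>_def)
  have "coverable V (\<epsilon> * real N) ((N + 1) ^ (Suc s * nat \<lceil>\<tau> * real N\<rceil>)) (indep_set w)"
    if V: "finite V" "card V \<le> N" and pos: "0 < N" "0 < D" "0 < \<tau>"
      and w: "uniform_weight V (Suc s) w" "\<delta> * D * real N \<le> deg V w {}"
      and cap: "\<forall>S\<subseteq>V. S \<noteq> {} \<longrightarrow> deg V w S \<le> c * \<tau> ^ (card S - 1) * D"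
    for V :: "'a set" and N D \<tau> w
  proof -
    define L where "L = nat \<lceil>\<gamma> * \<tau> * real N\<rceil>"
    define M where "M = (N + 1) ^ (s * nat \<lceil>\<tau> * real N\<rceil>)"
    have prod: "0 < \<gamma> * \<tau> * real N" using \<gamma> pos by simp
    then have L: "\<gamma> * \<tau> * real N \<le> real L" "real L \<le> \<gamma> * \<tau> * real N + 1"
      unfolding L_def by linarith+
    have "\<gamma> * \<tau> * real N \<le> 1 * \<tau> * real N"
      using \<gamma> pos by (intro mult_right_mono) auto
    then have LL: "L \<le> nat \<lceil>\<tau> * real N\<rceil>"
      unfolding L_def by (intro nat_mono ceiling_mono) simp
    have final: "coverable V (\<epsilon> * real N) M (indep_set w')"
      if st: "link_state V s \<tau> D (\<delta> / 4) c L w'" for w'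
    proof -
      \<comment> \<open>Each of the \<open>L\<close> links weighs at least
        \<open>\<delta> / 4 * D\<close>, so \<open>w'\<close> has density at least
        \<open>\<gamma> * (\<delta> / 4)\<close> relative to \<open>\<tau> * D\<close>.\<close>
      have "\<gamma> * (\<delta> / 4) * (\<tau> * D) * real N = (\<gamma> * \<tau> * real N) * (\<delta> / 4 * D)"
        by simp
      also have "\<dots> \<le> real L * (\<delta> / 4 * D)"
        using L(1) Suc.prems pos by (intro mult_right_mono) auto
      also have "\<dots> \<le> deg V w' {}"
        using st by (simp add: link_state_def)
      finally have tot: "\<gamma> * (\<delta> / 4) * (\<tau> * D) * real N \<le> deg V w' {}" .
      have cap': "deg V w' S \<le> (1 + c) * \<tau> ^ (card S - 1) * (\<tau> * D)"
        if S: "S \<subseteq> V" "S \<noteq> {}" for S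
      proof -
        have "card S \<noteq> 0" using S V(1) finite_subset by fastforce
        then have "\<tau> ^ card S = \<tau> ^ (card S - 1) * \<tau>"
          by (cases "card S") auto
        moreover have "deg V w' S \<le> (1 + c) * \<tau> ^ card S * D"
          using st S by (simp add: link_state_def)
        ultimately show ?thesis by (simp add: mult.assoc)
      qed
      have "coverable V (\<epsilon>' * real N) M (indep_set w')"
        unfolding M_def
        by (rule IH[OF V pos(1) _ pos(3) _ tot]) (use st pos cap' in \<open>auto simp: link_state_def\<close>)
      then show ?thesis
        by (rule coverable_mono) (use \<epsilon> in \<open>auto intro: mult_right_mono\<close>)
    qed
    \<comment> \<open>The procedure starts without links: every set is independent for the zero
      weight.\<close>
    have init: "link_state V s \<tau> D (\<delta> / 4) c 0 (\<lambda>_. 0)"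
      using Suc.prems pos by (auto simp: link_state_def uniform_weight_def deg_def)
    have "coverable V (\<epsilon> * real N) ((N + 1) ^ L * M)
        (\<lambda>I. indep_set w I \<and> indep_set (\<lambda>_. 0) I)"
      by (rule greedy_containers[OF V pos(2,3) Suc.prems(2,1) w _ \<gamma>(3) L(2) \<epsilon>(3) _ final _ init])
        (use cap in \<open>auto simp: M_def\<close>)
    then show ?thesis
    proof (rule coverable_mono)
      have "(N + 1) ^ L * M = (N + 1) ^ (L + s * nat \<lceil>\<tau> * real N\<rceil>)"
        by (simp add: M_def power_add)
      also have "\<dots> \<le> (N + 1) ^ (Suc s * nat \<lceil>\<tau> * real N\<rceil>)"
        using LL by (intro power_increasing) auto
      finally show "(N + 1) ^ L * M \<le> (N + 1) ^ (Suc s * nat \<lceil>\<tau> * real N\<rceil>)" .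
    qed (auto simp: indep_set_def)
  qed
  with \<epsilon>(1) show ?case by blast
qed

section \<open>Clauses, formulae and copies\<close>

text \<open>The common vertex set of the hypergraphs of copies; for finite \<open>X\<close> the
  formulae on \<open>X\<close> are its subsets.\<close>

definition all_clauses :: "nat \<Rightarrow> 'a set \<Rightarrow> 'a clause set" where
  "all_clauses k X = {c. k_clause k c \<and> clause_vars c \<subseteq> X}"

lemma finite_literals: "finite X \<Longrightarrow> finite {l. lit_var l \<in> X}"
  and card_literals: "finite X \<Longrightarrow> card {l. lit_var l \<in> X} = 2 * card X"
proof -
  assume X: "finite X"
  have eq: "{l. lit_var l \<in> X} = Pos ` X \<union> Neg ` X"
  proof (intro set_eqI)
    fix l show "l \<in> {l. lit_var l \<in> X} \<longleftrightarrow> l \<in> Pos ` X \<union> Neg ` X"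
      by (cases l) auto
  qed
  show "finite {l. lit_var l \<in> X}" using X by (simp add: eq)
  have "card (Pos ` X \<union> Neg ` X) = card (Pos ` X) + card (Neg ` X)"
    by (rule card_Un_disjoint) (use X in auto)
  then show "card {l. lit_var l \<in> X} = 2 * card X"
    by (simp add: eq card_image inj_on_def)
qed

lemma card_clause_vars: "k_clause k c \<Longrightarrow> card (clause_vars c) = k"
  by (simp add: clause_vars_def k_clause_def card_image)

lemma finite_clause_vars: "k_clause k c \<Longrightarrow> finite (clause_vars c)"
  by (simp add: clause_vars_def k_clause_def)

lemma finite_formula_vars: "ksat_formula k F \<Longrightarrow> finite (formula_vars F)"
  using finite_clause_vars by (auto simp: formula_vars_def ksat_formula_def)

lemma binomial_le_power: "n choose r \<le> n ^ r"
  by (cases "r \<le> n") (simp_all add: binomial_le_pow binomial_eq_0)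

text \<open>A clause is a set of \<open>k\<close> among the \<open>2 * card X\<close> literals. The
  crude count has the right order in \<open>card X\<close> and later serves as
  \<open>N\<close>.\<close>

lemma finite_all_clauses: "finite X \<Longrightarrow> finite (all_clauses k X)"
  and card_all_clauses: "finite X \<Longrightarrow> card (all_clauses k X) \<le> (2 * card X) ^ k"
proof -
  assume X: "finite X"
  let ?S = "{c. c \<subseteq> {l. lit_var l \<in> X} \<and> card c = k}"
  have sub: "all_clauses k X \<subseteq> ?S"
    by (auto simp: all_clauses_def k_clause_def clause_vars_def)
  have fin: "finite ?S"
    using finite_literals[OF X] by (auto intro: finite_subset[of _ "Pow {l. lit_var l \<in> X}"])
  show "finite (all_clauses k X)" using sub fin by (rule finite_subset)
  have "card (all_clauses k X) \<le> card ?S" using fin sub by (rule card_mono)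
  also have "\<dots> = (2 * card X) choose k"
    by (simp add: n_subsets finite_literals card_literals X)
  also have "\<dots> \<le> (2 * card X) ^ k" by (rule binomial_le_power)
  finally show "card (all_clauses k X) \<le> (2 * card X) ^ k" .
qed

lemma formulae_on_eq_Pow:
  assumes "finite X"
  shows "formulae_on k X = Pow (all_clauses k X)"
  using finite_subset[OF _ finite_all_clauses[OF assms]]
  by (auto simp: formulae_on_def all_clauses_def ksat_formula_def formula_vars_def)

section \<open>Relabelings and copies\<close>

lemma lit_var_map_literal: "lit_var (map_literal f l) = f (lit_var l)"
  by (cases l) simp_all

lemma clause_vars_map: "clause_vars (map_literal f ` c) = f ` clause_vars c"
  by (simp add: clause_vars_def lit_var_map_literal image_image)

lemma formula_vars_relabel: "formula_vars (relabel f F) = f ` formula_vars F"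
  by (auto simp: formula_vars_def relabel_def clause_vars_map)

lemma formula_vars_mono: "F \<subseteq> H \<Longrightarrow> formula_vars F \<subseteq> formula_vars H"
  by (auto simp: formula_vars_def)

lemma inj_on_map_clause:
  assumes "inj_on f (formula_vars F)"
  shows "inj_on (\<lambda>c. map_literal f ` c) F"
proof -
  let ?L = "{l. lit_var l \<in> formula_vars F}"
  have "inj_on (map_literal f) ?L"
  proof (rule inj_onI)
    fix l l' assume "l \<in> ?L" "l' \<in> ?L" "map_literal f l = map_literal f l'"
    then show "l = l'" using assms by (cases l; cases l') (auto dest: inj_onD)
  qed
  moreover have "c \<subseteq> ?L" if "c \<in> F" for c
    using that by (auto simp: formula_vars_def clause_vars_def)
  ultimately show ?thesis
    by (intro inj_onI) (metis inj_on_image_eq_iff)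
qed

lemma formula_iso_card: "formula_iso B H \<Longrightarrow> card H = card B"
  by (auto simp: formula_iso_def relabel_def card_image inj_on_map_clause)

lemma formula_iso_num_vars: "formula_iso B H \<Longrightarrow> card (formula_vars H) = num_vars B"
  by (auto simp: formula_iso_def num_vars_def formula_vars_relabel card_image)

lemma formula_iso_empty: "formula_iso B {} \<longleftrightarrow> B = {}"
  by (auto simp: formula_iso_def relabel_def formula_vars_def)

lemma formula_iso_simple:
  assumes "formula_iso B H" "simple_formula B"
  shows "simple_formula H"
proof -
  obtain f where f: "inj_on f (formula_vars B)" "H = relabel f B"
    using assms(1) by (auto simp: formula_iso_def)
  have "c = d" if "c \<in> B" "d \<in> B" "f ` clause_vars c = f ` clause_vars d" for c d
  proof -
    have "clause_vars c \<subseteq> formula_vars B" "clause_vars d \<subseteq> formula_vars B"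
      using that by (auto simp: formula_vars_def)
    then have "clause_vars c = clause_vars d"
      using that(3) f(1) by (simp add: inj_on_image_eq_iff)
    then show ?thesis using that assms(2) by (auto simp: simple_formula_def)
  qed
  then show ?thesis
    unfolding simple_formula_def f(2) relabel_def by (auto simp: clause_vars_map)
qed

text \<open>A copy is determined by its variables outside \<open>W\<close> and by a family of
  literal sets over the at most \<open>2 * num_vars B\<close> literals then available. The double
  exponential is a constant depending only on \<open>B\<close>.\<close>

lemma card_copies_containing:
  assumes X: "finite X" "formula_vars G \<subseteq> X" and W: "card W \<le> num_vars B"
  shows "card {H \<in> copies B G. W \<subseteq> formula_vars H}
    \<le> card X ^ (num_vars B - card W) * 2 ^ (2 ^ (2 * num_vars B))"
proof (cases "W \<subseteq> X")
  case False
  have "formula_vars H \<subseteq> X" if "H \<in> copies B G" for H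
    using that X(2) formula_vars_mono[of H G] by (auto simp: copies_def)
  with False have "{H \<in> copies B G. W \<subseteq> formula_vars H} = {}" by blast
  then show ?thesis by (simp only: card.empty)
next
  case True
  then have finW: "finite W" using X(1) by (rule finite_subset)
  let ?Z = "{Z. Z \<subseteq> X \<and> card Z = num_vars B - card W}"
  let ?P = "\<lambda>Z. Pow (Pow {l. lit_var l \<in> Z \<union> W})"
  have finZ: "finite ?Z" using X(1) by (auto intro: finite_subset[of _ "Pow X"])
  have finP: "finite (?P Z)" if "Z \<in> ?Z" for Z
    using that X(1) finW finite_literals[of "Z \<union> W"] by (auto intro: finite_subset)
  have "{H \<in> copies B G. W \<subseteq> formula_vars H} \<subseteq> (\<Union>Z\<in>?Z. ?P Z)"
  proof
    fix H assume "H \<in> {H \<in> copies B G. W \<subseteq> formula_vars H}"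
    then have H: "H \<subseteq> G" "formula_iso B H" "W \<subseteq> formula_vars H" by (auto simp: copies_def)
    have "formula_vars H - W \<in> ?Z"
      using H X(2) formula_vars_mono[OF H(1)] finW
      by (auto simp: card_Diff_subset formula_iso_num_vars)
    moreover have "H \<in> ?P (formula_vars H - W)"
      by (auto simp: formula_vars_def clause_vars_def)
    ultimately show "H \<in> (\<Union>Z\<in>?Z. ?P Z)" by blast
  qed
  then have "card {H \<in> copies B G. W \<subseteq> formula_vars H} \<le> card (\<Union>Z\<in>?Z. ?P Z)"
    using finZ finP by (intro card_mono) auto
  also have "\<dots> \<le> (\<Sum>Z\<in>?Z. card (?P Z))" by (rule card_UN_le[OF finZ])
  also have "\<dots> \<le> (\<Sum>Z\<in>?Z. 2 ^ (2 ^ (2 * num_vars B)))"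
  proof (rule sum_mono)
    fix Z assume Z: "Z \<in> ?Z"
    then have fin: "finite (Z \<union> W)" using X(1) finW by (auto intro: finite_subset)
    have "card (Z \<union> W) \<le> num_vars B"
      using card_Un_le[of Z W] Z W by simp
    then show "card (?P Z) \<le> 2 ^ (2 ^ (2 * num_vars B))"
      using card_literals[OF fin] finite_literals[OF fin]
      by (simp only: card_Pow finite_Pow_iff) (intro power_increasing; simp)
  qed
  also have "\<dots> = (card X choose (num_vars B - card W)) * 2 ^ (2 ^ (2 * num_vars B))"
    using X(1) by (simp add: n_subsets)
  also have "\<dots> \<le> card X ^ (num_vars B - card W) * 2 ^ (2 ^ (2 * num_vars B))"
    using binomial_le_power by (rule mult_right_mono) simp
  finally show ?thesis .
qed

section \<open>Codegrees in the hypergraph of copies\<close>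

lemma card_formula_vars_ge:
  assumes "ksat_formula k S" "S \<noteq> {}"
  shows "k \<le> card (formula_vars S)"
proof -
  obtain c where c: "c \<in> S" using assms by blast
  then have "card (clause_vars c) \<le> card (formula_vars S)"
    using finite_formula_vars[OF assms(1)] by (intro card_mono) (auto simp: formula_vars_def)
  then show ?thesis using c assms(1) card_clause_vars by (auto simp: ksat_formula_def)
qed

text \<open>Simplicity gives two clauses with different \<open>k\<close>-sets of variables, whose
  union has more than \<open>k\<close> elements. This extra variable is the source of the gain of a
  factor \<open>n\<close> in codegrees.\<close>

lemma card_formula_vars_gt:
  assumes S: "ksat_formula k S" "simple_formula S" "2 \<le> card S"
  shows "Suc k \<le> card (formula_vars S)"
proof -
  obtain c d where cd: "c \<in> S" "d \<in> S" "c \<noteq> d"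
    using S(1,3) by (metis card_le_Suc0_iff_eq ksat_formula_def not_less_eq_eq numeral_2_eq_2)
  have k: "k_clause k c" "k_clause k d" using cd S(1) by (auto simp: ksat_formula_def)
  have ne: "clause_vars c \<noteq> clause_vars d" using cd S(2) by (auto simp: simple_formula_def)
  have "clause_vars c \<subset> clause_vars c \<union> clause_vars d"
  proof -
    have "\<not> clause_vars d \<subseteq> clause_vars c"
      using ne card_subset_eq[OF finite_clause_vars[OF k(1)], of "clause_vars d"]
        card_clause_vars[OF k(1)] card_clause_vars[OF k(2)] by auto
    then show ?thesis by blast
  qed
  then have "k < card (clause_vars c \<union> clause_vars d)"
    using psubset_card_mono[of "clause_vars c \<union> clause_vars d" "clause_vars c"] k
    by (simp add: finite_clause_vars card_clause_vars)
  also have "\<dots> \<le> card (formula_vars S)"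
    using finite_formula_vars[OF S(1)] cd by (intro card_mono) (auto simp: formula_vars_def)
  finally show ?thesis by simp
qed

text \<open>For one clause this is the plain degree bound. Two or more clauses of a copy span at
  least \<open>k + 1\<close> variables, which saves a factor \<open>n\<close>. The density has
  \<open>(m - 1)\<close>-th power \<open>1 / n\<close>, so by \<open>card S \<le> m\<close> its
  power \<open>card S - 1\<close> is at least \<open>1 / n\<close>, and the saving suffices for all
  sizes of \<open>S\<close> at once.\<close>

lemma max_codegree_copies:
  fixes B :: "'a formula" and G :: "nat formula" and n m :: nat
  assumes B: "ksat_formula k B" "simple_formula B" "card B \<le> m" and m: "2 \<le> m"
    and n: "1 \<le> n" and G: "G \<subseteq> all_clauses k {1..n}" and S: "S \<subseteq> G" "S \<noteq> {}"
  shows "real (card {H \<in> copies B G. S \<subseteq> H})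
    \<le> 2 ^ (2 ^ (2 * num_vars B)) * (real n powr (- 1 / (real m - 1))) ^ (card S - 1)
        * real n ^ (num_vars B - k)"
proof (cases "\<exists>H\<in>copies B G. S \<subseteq> H")
  case False
  then have "{H \<in> copies B G. S \<subseteq> H} = {}" by blast
  then show ?thesis by (simp only: card.empty) simp
next
  case True
  let ?v = "num_vars B" and ?\<tau> = "real n powr (- 1 / (real m - 1))"
  let ?c = "2 ^ (2 ^ (2 * num_vars B)) :: real"
  obtain H where H: "H \<subseteq> G" "formula_iso B H" "S \<subseteq> H"
    using True by (auto simp: copies_def)
  have formG: "G \<in> formulae_on k {1..n}" using G by (simp add: formulae_on_eq_Pow)
  have "H \<in> formulae_on k {1..n}" "S \<in> formulae_on k {1..n}"
    using G H S by (auto simp: formulae_on_eq_Pow)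
  then have kH: "ksat_formula k H" and kS: "ksat_formula k S"
    by (auto simp: formulae_on_def)
  have finH: "finite H" using kH by (simp add: ksat_formula_def)
  \<comment> \<open>\<open>G\<close> need not be simple, but \<open>S\<close> lies in a copy of
    \<open>B\<close>.\<close>
  have simS: "simple_formula S"
    using formula_iso_simple[OF H(2) B(2)] H(3) unfolding simple_formula_def by blast
  have "card S \<le> card H" using finH H(3) by (rule card_mono)
  then have Sm: "card S \<le> m" using formula_iso_card[OF H(2)] B(3) by simp
  have W: "card (formula_vars S) \<le> ?v"
    using card_mono[OF finite_formula_vars[OF kH] formula_vars_mono[OF H(3)]]
      formula_iso_num_vars[OF H(2)] by simp
  have "finite G" using G by (rule finite_subset) (simp add: finite_all_clauses)
  then have finc: "finite (copies B G)"
    by (auto simp: copies_def intro: finite_subset[of _ "Pow G"])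
  have "card {H \<in> copies B G. S \<subseteq> H} \<le> card {H \<in> copies B G. formula_vars S \<subseteq> formula_vars H}"
    by (rule card_mono) (use finc formula_vars_mono in auto)
  also have "\<dots> \<le> card {1..n} ^ (?v - card (formula_vars S)) * 2 ^ (2 ^ (2 * ?v))"
    by (rule card_copies_containing) (use formG W in \<open>auto simp: formulae_on_def\<close>)
  finally have "real (card {H \<in> copies B G. S \<subseteq> H})
      \<le> real (n ^ (?v - card (formula_vars S)) * 2 ^ (2 ^ (2 * ?v)))"
    by (simp only: of_nat_le_iff card_atLeastAtMost diff_Suc_1)
  then have count: "real (card {H \<in> copies B G. S \<subseteq> H}) \<le> ?c * real n ^ (?v - card (formula_vars S))"
    by (simp add: mult.commute)
  have "real n ^ (?v - card (formula_vars S)) \<le> ?\<tau> ^ (card S - 1) * real n ^ (?v - k)"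
  proof (cases "card S \<ge> 2")
    case False
    then have "card S - 1 = 0" by simp
    moreover have "k \<le> card (formula_vars S)" by (rule card_formula_vars_ge[OF kS S(2)])
    ultimately show ?thesis
      using n by (simp add: power_increasing)
  next
    case True
    have k: "Suc k \<le> card (formula_vars S)" by (rule card_formula_vars_gt[OF kS simS True])
    have "real n powr (-1) \<le> real n powr (real (card S - 1) * (- 1 / (real m - 1)))"
    proof (rule powr_mono)
      have "real (card S - 1) \<le> real m - 1" using Sm True by linarith
      then show "- 1 \<le> real (card S - 1) * (- 1 / (real m - 1))"
        using m by (simp add: field_simps)
    qed (use n in simp)
    also have "\<dots> = ?\<tau> ^ (card S - 1)"
      using n by (simp add: powr_power mult.commute)
    finally have \<tau>: "1 / real n \<le> ?\<tau> ^ (card S - 1)"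
      using n by (simp add: powr_minus_divide)
    have "real n ^ (?v - card (formula_vars S)) \<le> real n ^ (?v - Suc k)"
      using n k by (intro power_increasing) auto
    also have "\<dots> = 1 / real n * real n ^ (?v - k)"
    proof -
      have "?v - k = Suc (?v - Suc k)" using k W by linarith
      then show ?thesis using n by simp
    qed
    also have "\<dots> \<le> ?\<tau> ^ (card S - 1) * real n ^ (?v - k)"
      using \<tau> by (rule mult_right_mono) simp
    finally show ?thesis .
  qed
  then have "?c * real n ^ (?v - card (formula_vars S)) \<le> ?c * (?\<tau> ^ (card S - 1) * real n ^ (?v - k))"
    by (rule mult_left_mono) simp
  with count show ?thesis by (simp only: mult.assoc)
qed

section \<open>Containers for formulae\<close>

text \<open>The copies of \<open>B\<close> are the edges of a \<open>card B\<close>-uniform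
  hypergraph on the clauses of \<open>G\<close>, and \<open>B\<close>-free subformulae are
  independent. The same \<open>N = (2 * n) ^ k\<close> is taken for every \<open>G\<close>, so that
  each round omits at least the same amount.\<close>

lemma containers_one_formula:
  fixes B :: "'a formula" and m :: nat
  assumes B: "ksat_formula k B" "simple_formula B" "card B \<le> m" "B \<noteq> {}" and m: "2 \<le> m"
    and \<delta>: "0 < \<delta>"
  shows "\<exists>\<epsilon>>0. \<forall>n\<ge>1. \<forall>G \<subseteq> all_clauses k {1..n}.
    \<delta> * real n ^ num_vars B < real (card (copies B G)) \<longrightarrow>
    coverable G (\<epsilon> * real ((2 * n) ^ k))
      (((2 * n) ^ k + 1) ^ (m * nat \<lceil>real n powr (- 1 / (real m - 1)) * real ((2 * n) ^ k)\<rceil>))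
      (\<lambda>F. copies B F = {})"
proof -
  let ?v = "num_vars B"
  let ?c = "2 ^ (2 ^ (2 * num_vars B)) :: real"
  have kv: "k \<le> ?v" using card_formula_vars_ge[OF B(1,4)] by (simp add: num_vars_def)
  \<comment> \<open>With \<open>D = n ^ (num_vars B - k)\<close>, the product of \<open>D\<close>
    and \<open>N\<close> is \<open>2 ^ k * n ^ num_vars B\<close>; dividing by \<open>2 ^ k\<close>
    restores the threshold for copies.\<close>
  have "0 < \<delta> / 2 ^ k" "0 < ?c" using \<delta> by auto
  from hypergraph_containers[OF this, of "card B", where 'a = "nat clause"]
  obtain \<epsilon> where \<epsilon>: "\<epsilon> > 0" and cont:
    "\<And>(V :: nat clause set) N D \<tau> w. finite V \<Longrightarrow> card V \<le> N \<Longrightarrow> 0 < N \<Longrightarrow> 0 < D \<Longrightarrow> 0 < \<tau> \<Longrightarrow>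
      uniform_weight V (card B) w \<Longrightarrow> \<delta> / 2 ^ k * D * real N \<le> deg V w {} \<Longrightarrow>
      (\<forall>S\<subseteq>V. S \<noteq> {} \<longrightarrow> deg V w S \<le> ?c * \<tau> ^ (card S - 1) * D) \<Longrightarrow>
      coverable V (\<epsilon> * real N) ((N + 1) ^ (card B * nat \<lceil>\<tau> * real N\<rceil>)) (indep_set w)"
    by blast
  have "coverable G (\<epsilon> * real ((2 * n) ^ k))
      (((2 * n) ^ k + 1) ^ (m * nat \<lceil>real n powr (- 1 / (real m - 1)) * real ((2 * n) ^ k)\<rceil>))
      (\<lambda>F. copies B F = {})"
    if n: "1 \<le> n" and G: "G \<subseteq> all_clauses k {1..n}"
      and many: "\<delta> * real n ^ ?v < real (card (copies B G))" for n :: nat and G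
  proof -
    let ?w = "\<lambda>e. if e \<in> copies B G then 1 else 0 :: real"
    let ?\<tau> = "real n powr (- 1 / (real m - 1))"
    let ?N = "(2 * n) ^ k"
    have finG: "finite G" using G by (rule finite_subset) (simp add: finite_all_clauses)
    have "card G \<le> card (all_clauses k {1..n})"
      using finite_all_clauses[of "{1..n}"] G by (intro card_mono) auto
    then have cardG: "card G \<le> ?N" using card_all_clauses[of "{1..n}" k] by simp
    have deg: "deg G ?w S = real (card {H \<in> copies B G. S \<subseteq> H})" for S
    proof -
      have "deg G ?w S = (\<Sum>e\<in>{H \<in> copies B G. S \<subseteq> H}. 1)"
        unfolding deg_def using finG
        by (intro sum.mono_neutral_cong_right) (auto simp: copies_def)
      then show ?thesis by simp
    qed
    have uni: "uniform_weight G (card B) ?w"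
      by (auto simp: uniform_weight_def copies_def formula_iso_card)
    have "real n ^ (?v - k) * real n ^ k = real n ^ ?v"
      using kv by (simp flip: power_add)
    then have "\<delta> / 2 ^ k * real n ^ (?v - k) * real ?N = \<delta> * real n ^ ?v"
      by (simp add: power_mult_distrib)
    also have "\<dots> \<le> deg G ?w {}"
      using many by (simp add: deg)
    finally have tot: "\<delta> / 2 ^ k * real n ^ (?v - k) * real ?N \<le> deg G ?w {}" .
    have cap: "\<forall>S\<subseteq>G. S \<noteq> {} \<longrightarrow> deg G ?w S \<le> ?c * ?\<tau> ^ (card S - 1) * real n ^ (?v - k)"
      unfolding deg using max_codegree_copies[OF B(1-3) m n G] by blast
    have "coverable G (\<epsilon> * real ?N) ((?N + 1) ^ (card B * nat \<lceil>?\<tau> * real ?N\<rceil>)) (indep_set ?w)"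
      by (rule cont[OF finG cardG _ _ _ uni tot cap]) (use n in auto)
    then show ?thesis
    proof (rule coverable_mono)
      show "(?N + 1) ^ (card B * nat \<lceil>?\<tau> * real ?N\<rceil>) \<le> (?N + 1) ^ (m * nat \<lceil>?\<tau> * real ?N\<rceil>)"
        using B(3) by (intro power_increasing mult_right_mono) auto
    qed (auto simp: indep_set_def copies_def)
  qed
  with \<epsilon> show ?thesis by blast
qed

text \<open>A set that is not \<open>good\<close> is replaced by containers with at least
  \<open>x\<close> fewer elements each. So the tree of refinements has depth at most
  \<open>t\<close>, where only the empty set remains, and at most \<open>M ^ t\<close>
  leaves.\<close>

lemma iterated_containers:
  assumes "finite V" "0 < x" "1 \<le> M" "good {}"
    and step: "\<And>G. G \<subseteq> V \<Longrightarrow> \<not> good G \<Longrightarrow> coverable G x M P"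
  shows "G \<subseteq> V \<Longrightarrow> real (card G) \<le> real t * x \<Longrightarrow>
    \<exists>\<C>. finite \<C> \<and> card \<C> \<le> M ^ t \<and> (\<forall>C\<in>\<C>. C \<subseteq> V \<and> good C) \<and>
      (\<forall>I\<subseteq>G. P I \<longrightarrow> (\<exists>C\<in>\<C>. I \<subseteq> C))"
proof (induction t arbitrary: G)
  case 0
  then have "G = {}" using assms(1) finite_subset by fastforce
  then show ?case using assms(4) by (intro exI[of _ "{{}}"]) auto
next
  case (Suc t)
  show ?case
  proof (cases "good G")
    case True
    have "1 \<le> M ^ Suc t" using assms(3) by (rule one_le_power)
    then show ?thesis
      using True Suc.prems by (intro exI[of _ "{G}"]) auto
  next
    case False
    from step[OF Suc.prems(1) False] obtain \<C> where "finite \<C> \<and> card \<C> \<le> M \<and>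
        (\<forall>C\<in>\<C>. C \<subseteq> G \<and> x \<le> real (card (G - C))) \<and> (\<forall>I\<subseteq>G. P I \<longrightarrow> (\<exists>C\<in>\<C>. I \<subseteq> C))"
      unfolding coverable_def ..
    then have \<C>: "finite \<C>" "card \<C> \<le> M" "\<And>C. C \<in> \<C> \<Longrightarrow> C \<subseteq> G"
      "\<And>C. C \<in> \<C> \<Longrightarrow> x \<le> real (card (G - C))"
      "\<And>I. I \<subseteq> G \<Longrightarrow> P I \<Longrightarrow> \<exists>C\<in>\<C>. I \<subseteq> C"
      by blast+
    have finG: "finite G" using Suc.prems(1) assms(1) by (rule finite_subset)
    have "\<exists>\<D>. finite \<D> \<and> card \<D> \<le> M ^ t \<and> (\<forall>C\<in>\<D>. C \<subseteq> V \<and> good C) \<and>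
      (\<forall>I\<subseteq>C. P I \<longrightarrow> (\<exists>C\<in>\<D>. I \<subseteq> C))" if C: "C \<in> \<C>" for C
    proof (rule Suc.IH)
      show "C \<subseteq> V" using \<C>(3)[OF C] Suc.prems by blast
      have "card (G - C) + card C = card G"
        using \<C>(3)[OF C] finG by (simp add: card_Diff_subset card_mono finite_subset)
      then show "real (card C) \<le> real t * x"
        using \<C>(4)[OF C] Suc.prems(2) by (simp add: algebra_simps)
    qed
    then obtain \<D> where \<D>: "finite (\<D> C) \<and> card (\<D> C) \<le> M ^ t \<and>
      (\<forall>C'\<in>\<D> C. C' \<subseteq> V \<and> good C') \<and> (\<forall>I\<subseteq>C. P I \<longrightarrow> (\<exists>C'\<in>\<D> C. I \<subseteq> C'))"
      if "C \<in> \<C>" for C by metis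
    have "card (\<Union>C\<in>\<C>. \<D> C) \<le> (\<Sum>C\<in>\<C>. card (\<D> C))" by (rule card_UN_le[OF \<C>(1)])
    also have "\<dots> \<le> (\<Sum>C\<in>\<C>. M ^ t)" by (rule sum_mono) (use \<D> in auto)
    also have "\<dots> \<le> M ^ Suc t" using \<C>(2) by simp
    finally have card: "card (\<Union>C\<in>\<C>. \<D> C) \<le> M ^ Suc t" .
    have "\<exists>C'\<in>(\<Union>C\<in>\<C>. \<D> C). I \<subseteq> C'" if I: "I \<subseteq> G" "P I" for I
    proof -
      obtain C where C: "C \<in> \<C>" "I \<subseteq> C" using \<C>(5)[OF I] by blast
      with \<D>[OF C(1)] I(2) obtain C' where "C' \<in> \<D> C" "I \<subseteq> C'" by blast
      with C(1) show ?thesis by blast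
    qed
    moreover have "finite (\<Union>C\<in>\<C>. \<D> C)" "\<forall>C'\<in>(\<Union>C\<in>\<C>. \<D> C). C' \<subseteq> V \<and> good C'"
      using \<C>(1) \<D> by auto
    ultimately show ?thesis
      using card by (intro exI[of _ "\<Union>C\<in>\<C>. \<D> C"]) blast
  qed
qed

text \<open>If a copy has only one clause, that clause already lies in a single free formula, so the
  union of all free formulae is still free. One container then suffices in the degenerate
  cases.\<close>

lemma free_union_free:
  assumes "finite X" "{} \<notin> \<B>"
    and single: "\<And>B H. B \<in> \<B> \<Longrightarrow> H \<subseteq> all_clauses k X \<Longrightarrow> formula_iso B H \<Longrightarrow> card H \<le> 1"
  shows "\<exists>G\<in>formulae_on k X. (\<forall>F\<in>formulae_on k X. free_of \<B> F \<longrightarrow> F \<subseteq> G) \<and>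
    (\<forall>B\<in>\<B>. copies B G = {})"
proof -
  let ?G = "\<Union>{F\<in>formulae_on k X. free_of \<B> F}"
  have GX: "?G \<subseteq> all_clauses k X"
    using formulae_on_eq_Pow[OF assms(1)] by auto
  have False if B: "B \<in> \<B>" and H: "H \<in> copies B ?G" for B H
  proof -
    have HG: "H \<subseteq> ?G" "formula_iso B H" using H by (auto simp: copies_def)
    then have "finite H" "H \<noteq> {}"
      using GX finite_all_clauses[OF assms(1)] B assms(2) formula_iso_empty
      by (meson finite_subset, metis)
    moreover have "card H \<le> 1" using single[OF B _ HG(2)] HG(1) GX by blast
    ultimately obtain c where c: "H = {c}"
      by (metis card_0_eq card_1_singletonE le_neq_implies_less less_one)
    then obtain F where "free_of \<B> F" "c \<in> F" using HG(1) by auto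
    then show False using B HG(2) c by (auto simp: free_of_def copies_def)
  qed
  moreover have "?G \<in> formulae_on k X"
    using GX formulae_on_eq_Pow[OF assms(1)] by auto
  ultimately show ?thesis by (intro bexI[of _ ?G]) auto
qed

text \<open>Starting from all clauses, a formula with too many copies of some \<open>B\<close> is
  refined by the containers for that \<open>B\<close>. Each round omits a fixed proportion of
  \<open>(2 * n) ^ k\<close>, so the number \<open>t\<close> of rounds does not depend on
  \<open>n\<close>.\<close>

lemma containers_formula_family:
  fixes \<B> :: "'a formula set" and m :: nat
  assumes "finite \<B>" "{} \<notin> \<B>" and m: "2 \<le> m" and k: "1 \<le> k" and \<delta>: "0 < \<delta>"
    and B: "\<And>B. B \<in> \<B> \<Longrightarrow> ksat_formula k B \<and> simple_formula B \<and> card B \<le> m"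
  shows "\<exists>C>0. \<forall>n\<ge>2. \<exists>\<G>. finite \<G> \<and> \<G> \<subseteq> formulae_on k {1..n} \<and>
      (\<forall>F \<in> formulae_on k {1..n}. free_of \<B> F \<longrightarrow> (\<exists>G\<in>\<G>. F \<subseteq> G)) \<and>
      (\<forall>G\<in>\<G>. \<forall>B\<in>\<B>. real (card (copies B G)) \<le> \<delta> * real n ^ num_vars B) \<and>
      real (card \<G>) \<le> real n powr (C * real n powr (real k - 1 / (real m - 1)))"
proof -
  let ?N = "\<lambda>n::nat. (2 * n) ^ k"
  let ?q = "\<lambda>n. nat \<lceil>real n powr (- 1 / (real m - 1)) * real (?N n)\<rceil>"
  let ?M = "\<lambda>n. (?N n + 1) ^ (m * ?q n)"
  let ?cov = "\<lambda>\<epsilon> B. \<forall>n\<ge>1. \<forall>G \<subseteq> all_clauses k {1..n}.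
    \<delta> * real n ^ num_vars B < real (card (copies B G)) \<longrightarrow>
    coverable G (\<epsilon> * real (?N n)) (?M n) (\<lambda>F. copies B F = {})"
  have "\<forall>B\<in>\<B>. \<exists>\<epsilon>>0. ?cov \<epsilon> B"
    using containers_one_formula B m \<delta> assms(2) by blast
  then obtain e where e: "\<And>B. B \<in> \<B> \<Longrightarrow> 0 < e B" "\<And>B. B \<in> \<B> \<Longrightarrow> ?cov (e B) B"
    by metis
  define \<epsilon> where "\<epsilon> = Min (insert 1 (e ` \<B>))"
  have \<epsilon>: "0 < \<epsilon>" "\<And>B. B \<in> \<B> \<Longrightarrow> \<epsilon> \<le> e B"
    using e(1) assms(1) by (auto simp: \<epsilon>_def)
  define t where "t = nat \<lceil>1 / \<epsilon>\<rceil>"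
  have "1 / \<epsilon> \<le> real t" by (simp add: t_def real_nat_ceiling_ge)
  then have t: "1 \<le> real t * \<epsilon>" using \<epsilon>(1) by (simp add: field_simps)
  \<comment> \<open>The factors come from \<open>?N n + 1 \<le> n ^ (2 * k + 1)\<close>, from the
    exponent \<open>m * ?q n\<close> in each of \<open>t\<close> rounds, and from the bound on
    \<open>?q n\<close> below.\<close>
  define C where "C = real ((2 * k + 1) * m * t) * (2 ^ k + 1)"
  have "0 < t" using \<epsilon>(1) by (simp add: t_def)
  then have "0 < real ((2 * k + 1) * m * t)" using m by (simp only: of_nat_0_less_iff) simp
  then have "0 < C" unfolding C_def by (rule mult_pos_pos) (simp add: add_pos_pos)
  moreover have "\<exists>\<G>. finite \<G> \<and> \<G> \<subseteq> formulae_on k {1..n} \<and>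
      (\<forall>F \<in> formulae_on k {1..n}. free_of \<B> F \<longrightarrow> (\<exists>G\<in>\<G>. F \<subseteq> G)) \<and>
      (\<forall>G\<in>\<G>. \<forall>B\<in>\<B>. real (card (copies B G)) \<le> \<delta> * real n ^ num_vars B) \<and>
      real (card \<G>) \<le> real n powr (C * real n powr (real k - 1 / (real m - 1)))"
    if n: "2 \<le> n" for n
  proof -
    let ?good = "\<lambda>G :: nat formula. \<forall>B\<in>\<B>. real (card (copies B G)) \<le> \<delta> * real n ^ num_vars B"
    let ?V = "all_clauses k {1..n}"
    have finV: "finite ?V" by (rule finite_all_clauses) simp
    have good0: "?good {}"
    proof
      fix B assume "B \<in> \<B>"
      then have "copies B ({} :: nat formula) = {}"
        using assms(2) by (auto simp: copies_def formula_iso_empty)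
      then show "real (card (copies B ({} :: nat formula))) \<le> \<delta> * real n ^ num_vars B"
        using \<delta> by (simp only: card.empty) simp
    qed
    have step: "coverable G (\<epsilon> * real (?N n)) (?M n) (free_of \<B>)"
      if G: "G \<subseteq> ?V" "\<not> ?good G" for G
    proof -
      obtain B where B: "B \<in> \<B>" "\<delta> * real n ^ num_vars B < real (card (copies B G))"
        using G(2) by (meson not_le)
      have "coverable G (e B * real (?N n)) (?M n) (\<lambda>F. copies B F = {})"
        by (rule e(2)[OF B(1), rule_format, OF _ G(1) B(2)]) (use n in simp)
      then show ?thesis
      proof (rule coverable_mono)
        show "\<epsilon> * real (?N n) \<le> e B * real (?N n)"
          using \<epsilon>(2)[OF B(1)] by (rule mult_right_mono) simp
      qed (use B(1) in \<open>auto simp: free_of_def\<close>)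
    qed
    have "card ?V \<le> ?N n" using card_all_clauses[of "{1..n}" k] by simp
    then have "real (card ?V) \<le> 1 * real (?N n)" by (simp only: of_nat_le_iff mult_1)
    also have "\<dots> \<le> (real t * \<epsilon>) * real (?N n)" using t by (rule mult_right_mono) simp
    finally have size: "real (card ?V) \<le> real t * (\<epsilon> * real (?N n))" by (simp only: mult.assoc)
    have "0 < \<epsilon> * real (?N n)" using \<epsilon>(1) n by simp
    from iterated_containers[where P = "free_of \<B>" and good = ?good,
        OF finV this _ good0 step subset_refl size]
    obtain \<G> where \<G>: "finite \<G>" "card \<G> \<le> ?M n ^ t" "\<forall>G\<in>\<G>. G \<subseteq> ?V \<and> ?good G"
      "\<forall>F\<subseteq>?V. free_of \<B> F \<longrightarrow> (\<exists>G\<in>\<G>. F \<subseteq> G)" by auto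
    let ?x = "real n powr (real k - 1 / (real m - 1))"
    \<comment> \<open>With \<open>1 \<le> k\<close> this gives \<open>1 \<le> ?x\<close>, which
      absorbs the 1 lost to rounding up in \<open>?q n\<close>.\<close>
    have "1 / (real m - 1) \<le> 1" using m by simp
    then have x1: "1 \<le> ?x" using n k by (intro ge_one_powr_ge_zero) auto
    have "real n powr (- 1 / (real m - 1)) * real (?N n) = 2 ^ k * ?x"
      using n by (simp add: power_mult_distrib powr_diff powr_realpow powr_minus_divide)
    moreover have "0 \<le> 2 ^ k * ?x" by simp
    ultimately have "real (?q n) \<le> 2 ^ k * ?x + 1"
      by (simp only: of_nat_nat ceiling_le_iff zero_le_ceiling) linarith
    also have "\<dots> \<le> (2 ^ k + 1) * ?x" using x1 by (simp add: algebra_simps)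
    finally have q: "real (?q n) \<le> (2 ^ k + 1) * ?x" .
    \<comment> \<open>As \<open>n\<close> is at least 2, \<open>2 * n \<le> n * n\<close>, and one
      further factor \<open>n\<close> absorbs the added 1.\<close>
    have N: "?N n + 1 \<le> n ^ (2 * k + 1)"
    proof -
      have "?N n \<le> (n * n) ^ k" using n by (intro power_mono mult_right_mono) auto
      also have "\<dots> = n ^ (2 * k)" by (simp add: power_mult power2_eq_square)
      finally have "?N n + 1 \<le> n ^ (2 * k) + n ^ (2 * k)"
        using n one_le_power[of n "2 * k"] by linarith
      also have "\<dots> \<le> n * n ^ (2 * k)" using n by (simp flip: mult_2)
      finally show ?thesis by simp
    qed
    have "card \<G> \<le> (n ^ (2 * k + 1)) ^ (m * ?q n * t)"
      using \<G>(2) power_mono[OF N, of "m * ?q n * t"] by (simp add: power_mult)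
    then have "real (card \<G>) \<le> real (n ^ ((2 * k + 1) * (m * ?q n * t)))"
      by (simp only: of_nat_le_iff power_mult)
    also have "\<dots> = real n powr real ((2 * k + 1) * (m * ?q n * t))"
      using n by (simp only: of_nat_power) (subst powr_realpow; simp)
    also have "\<dots> \<le> real n powr (C * ?x)"
    proof (rule powr_mono)
      have "real ((2 * k + 1) * (m * ?q n * t)) = real ((2 * k + 1) * m * t) * real (?q n)"
        by (simp only: of_nat_mult mult.assoc mult.commute mult.left_commute)
      also have "\<dots> \<le> real ((2 * k + 1) * m * t) * ((2 ^ k + 1) * ?x)"
        using q by (rule mult_left_mono) simp
      finally show "real ((2 * k + 1) * (m * ?q n * t)) \<le> C * ?x"
        by (simp only: C_def mult.assoc)
    qed (use n in simp)
    finally show ?thesis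
      using \<G> by (intro exI[of _ \<G>]) (auto simp: formulae_on_eq_Pow)
  qed
  ultimately show ?thesis by blast
qed

theorem theorem3p5:
  fixes k :: nat and \<B> :: "'a formula set" and \<delta> :: real
  assumes "finite \<B>" and "\<B> \<noteq> {}"
    and "\<And>B. B \<in> \<B> \<Longrightarrow> ksat_formula k B \<and> simple_formula B"
    and "\<delta> > 0"
  shows "\<exists>C::real. C > 0 \<and> (\<forall>n::nat. n \<ge> 1 \<longrightarrow>
    (\<exists>\<G> :: nat formula set. finite \<G> \<and> \<G> \<subseteq> formulae_on k {1..n} \<and>
      (\<forall>F \<in> formulae_on k {1..n}. free_of \<B> F \<longrightarrow> (\<exists>G\<in>\<G>. F \<subseteq> G)) \<and>
      (\<forall>G\<in>\<G>. \<forall>B\<in>\<B>. real (card (copies B G)) \<le> \<delta> * real n ^ num_vars B) \<and>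
      real (card \<G>) \<le>
        real n powr (C * real n powr (real k - 1 / (real (max_clauses \<B>) - 1)))))"
  (is "\<exists>C. C > 0 \<and> (\<forall>n. n \<ge> 1 \<longrightarrow> (\<exists>\<G>. ?containers C n \<G>))")
proof (cases "{} \<in> \<B>")
  case True
  \<comment> \<open>The empty formula has a copy everywhere, so no formula is free and the empty
    collection works.\<close>
  have "{} \<in> copies {} F" for F :: "nat formula"
    by (simp add: copies_def formula_iso_empty)
  then have "\<not> free_of \<B> F" for F :: "nat formula"
    using True by (auto simp: free_of_def)
  then have "?containers 1 n {}" for n by simp
  then show ?thesis by (intro exI[of _ 1]) (auto simp del: card.empty)
next
  case False
  let ?m = "max_clauses \<B>"
  have m: "card B \<le> ?m" if "B \<in> \<B>" for B
    using that assms(1) by (simp add: max_clauses_def)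
  \<comment> \<open>One container always meets the bound, because the base is at least 1 and the
    exponent is nonnegative.\<close>
  have trivial: "\<exists>\<G>. ?containers C n \<G>"
    if n: "1 \<le> n"
      and single: "\<And>B H. B \<in> \<B> \<Longrightarrow> H \<subseteq> all_clauses k {1..n} \<Longrightarrow> formula_iso B H \<Longrightarrow>
        card H \<le> 1"
      and C: "0 < C" for C n
  proof -
    obtain G where G: "G \<in> formulae_on k {1..n}"
      "\<forall>F\<in>formulae_on k {1..n}. free_of \<B> F \<longrightarrow> F \<subseteq> G" "\<forall>B\<in>\<B>. copies B G = {}"
      using free_union_free[of "{1..n}" \<B> k] False single by auto
    have "1 \<le> real n powr (C * real n powr (real k - 1 / (real ?m - 1)))"
      using n C by (intro ge_one_powr_ge_zero) auto
    then have "?containers C n {G}" using G assms(4) by simp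
    then show ?thesis by blast
  qed
  show ?thesis
  proof (cases "?m \<le> 1")
    case True
    \<comment> \<open>Here \<open>?m = 1\<close>, so the fraction in the exponent divides by zero
      and equals 0; one container meets the bound regardless.\<close>
    have "card H \<le> 1" if "B \<in> \<B>" "formula_iso B H" for B and H :: "nat formula"
      using m[OF that(1)] formula_iso_card[OF that(2)] True by linarith
    then have "\<exists>\<G>. ?containers 1 n \<G>" if "1 \<le> n" for n
      using that by (intro trivial) (assumption, blast, rule zero_less_one)
    then show ?thesis
      by (intro exI[of _ 1] conjI allI impI zero_less_one)
  next
    case m2: False
    \<comment> \<open>For \<open>k = 0\<close> the only clause is \<open>{}\<close>, so a formula
      has at most one clause.\<close>
    have "k \<noteq> 0"
    proof
      assume "k = 0"
      have "?m \<in> card ` \<B>" using assms(1,2) by (simp add: max_clauses_def)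
      then obtain B where B: "B \<in> \<B>" "card B = ?m" by auto
      have "B \<subseteq> {{}}"
        using assms(3)[OF B(1)] \<open>k = 0\<close> by (auto simp: ksat_formula_def k_clause_def)
      from card_mono[OF _ this] have "card B \<le> 1" by simp
      with B m2 show False by simp
    qed
    then have "1 \<le> k" "2 \<le> ?m" using m2 by auto
    with containers_formula_family[OF assms(1) False _ _ assms(4), of ?m k] assms(3) m
    obtain C where C: "0 < C" "\<And>n. 2 \<le> n \<Longrightarrow> \<exists>\<G>. ?containers C n \<G>" by blast
    \<comment> \<open>For \<open>n = 1\<close> the bound equals 1, so a single container must do.
      All clauses then have the same variables, and a simple copy contains at most one of
      them.\<close>
    have one: "\<exists>\<G>. ?containers C 1 \<G>"
    proof (rule trivial)
      fix B and H :: "nat formula"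
      assume B: "B \<in> \<B>" and H: "H \<subseteq> all_clauses k {1..1}" "formula_iso B H"
      have simple: "simple_formula H" using formula_iso_simple[OF H(2)] assms(3)[OF B] by blast
      have "c = d" if "c \<in> H" "d \<in> H" for c d
      proof -
        have "k_clause k c" "k_clause k d" "clause_vars c \<subseteq> {1}" "clause_vars d \<subseteq> {1}"
          using that H(1) by (auto simp: all_clauses_def)
        moreover from this have "card (clause_vars c) = card (clause_vars d)"
          by (simp add: card_clause_vars)
        ultimately have "clause_vars c = clause_vars d" by (auto simp: subset_singleton_iff)
        with simple that show ?thesis by (simp add: simple_formula_def)
      qed
      moreover have "finite H" using finite_subset[OF H(1) finite_all_clauses] by simp
      ultimately show "card H \<le> 1" by (simp add: card_le_Suc0_iff_eq)
    qed (use C(1) in simp_all)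
    have "\<exists>\<G>. ?containers C n \<G>" if "1 \<le> n" for n
    proof (cases "n = 1")
      case True
      show ?thesis unfolding True by (rule one)
    next
      case False
      with that have "2 \<le> n" by simp
      then show ?thesis by (rule C(2))
    qed
    then have "\<forall>n. n \<ge> 1 \<longrightarrow> (\<exists>\<G>. ?containers C n \<G>)" by (intro allI impI)
    with C(1) show ?thesis by (intro exI[of _ C] conjI)
  qed
qed

end
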